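(* Let $n>8$ and let $G$ be a divisible design graph with parameters $(4n,3n-2,3n-6,2n-2,4,n)$. Then there exist a divisible design graph $H$ with parameters $(4n,n+2,n-2,2,4,n)$ and a numbering $W_1,W_2,W_3,W_4$ of the classes of a canonical partition of $H$ for which the quotient matrix of $H$ equals one of $$\begin{pmatrix} n-1&1&1&1\\ 1&n-1&1&1\\ 1&1&n-1&1\\ 1&1&1&n-1\end{pmatrix},\quad \begin{pmatrix} 1&n-1&1&1\\ n-1&1&1&1\\ 1&1&n-1&1\\ 1&1&1&n-1\end{pmatrix},\quad \begin{pmatrix} 1&n-1&1&1\\ n-1&1&1&1\\ 1&1&1&n-1\\ 1&1&n-1&1\end{pmatrix},$$ such that $G$ is isomorphic to the graph obtained from $H$ by switching between the first two and the last two classes, i.e. by complementing every adjacency between a vertex of $W_1\cup W_2$ and a vertex of $W_3\cup W_4$ (all other adjacencies unchanged).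
   Context: A divisible design graph (DDG) with parameters $(v,k,\lambda_1,\lambda_2,m,n)$ is a $k$-regular graph on $v=mn$ vertices whose vertex set can be partitioned into $m$ classes of size $n$ (a canonical partition) such that any two distinct vertices in the same class have exactly $\lambda_1$ common neighbours and any two vertices in different classes have exactly $\lambda_2$ common neighbours. For a DDG with $\lambda_1\neq\lambda_2$ the canonical partition is equitable: each vertex of class $W_i$ has the same number $r_{ij}$ of neighbours in class $W_j$, and $(r_{ij})$ is the quotient matrix. *)

theory Defs
  imports
    "HOL-Library.Disjoint_Sets"
    "Graph_Theory.Pair_Digraph"
    "Graph_Theory.Digraph_Isomorphism"
    "Jordan_Normal_Form.Matrix"
begin

text \<open>
  Finite simple graphs are the \<^locale>\<open>pair_graph\<close> structures: finite, loop-free, and with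
  every edge uv represented by both arcs (u, v) and (v, u).
\<close>

definition neighbours :: "'a pair_pre_digraph \<Rightarrow> 'a \<Rightarrow> 'a set" where
  "neighbours G x = {y. (x, y) \<in> parcs G}"

definition canonical_partition ::
  "'a pair_pre_digraph \<Rightarrow> nat \<Rightarrow> nat \<Rightarrow> nat \<Rightarrow> nat \<Rightarrow> 'a set set \<Rightarrow> bool" where
  "canonical_partition G lam1 lam2 m n P \<longleftrightarrow>
     partition_on (pverts G) P \<and> card P = m \<and> (\<forall>C\<in>P. card C = n) \<and>
     (\<forall>C\<in>P. \<forall>x\<in>C. \<forall>y\<in>C. x \<noteq> y \<longrightarrow> card (neighbours G x \<inter> neighbours G y) = lam1) \<and>
     (\<forall>C\<in>P. \<forall>D\<in>P. C \<noteq> D \<longrightarrow>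
        (\<forall>x\<in>C. \<forall>y\<in>D. card (neighbours G x \<inter> neighbours G y) = lam2))"

definition divisible_design_graph ::
  "'a pair_pre_digraph \<Rightarrow> nat \<Rightarrow> nat \<Rightarrow> nat \<Rightarrow> nat \<Rightarrow> nat \<Rightarrow> nat \<Rightarrow> bool" where
  "divisible_design_graph G v k lam1 lam2 m n \<longleftrightarrow>
     pair_graph G \<and> v = m * n \<and> card (pverts G) = v \<and>
     (\<forall>x\<in>pverts G. card (neighbours G x) = k) \<and>
     (\<exists>P. canonical_partition G lam1 lam2 m n P)"

text \<open>
  A numbering of the classes is a list \<open>Ws\<close> without repetitions; the class written W with
  index i + 1 on paper is \<open>Ws ! i\<close>. For nonempty classes the matrix \<open>R\<close> below
  is uniquely determined, and it exists exactly when the partition is equitable.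
\<close>

definition numbering_of :: "'a set list \<Rightarrow> 'a set set \<Rightarrow> bool" where
  "numbering_of Ws P \<longleftrightarrow> distinct Ws \<and> set Ws = P"

definition has_quotient_matrix :: "'a pair_pre_digraph \<Rightarrow> 'a set list \<Rightarrow> nat mat \<Rightarrow> bool" where
  "has_quotient_matrix G Ws R \<longleftrightarrow>
     R \<in> carrier_mat (length Ws) (length Ws) \<and>
     (\<forall>i < length Ws. \<forall>j < length Ws. \<forall>x \<in> Ws ! i.
        card (neighbours G x \<inter> Ws ! j) = R $$ (i, j))"

text \<open>Intended for disjoint vertex sets \<open>X\<close> and \<open>Y\<close>.\<close>

definition switching :: "'a pair_pre_digraph \<Rightarrow> 'a set \<Rightarrow> 'a set \<Rightarrow> 'a pair_pre_digraph" where
  "switching G X Y =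
     \<lparr> pverts = pverts G, parcs = sym_diff (parcs G) (X \<times> Y \<union> Y \<times> X) \<rparr>"

end

theory Submission
  imports Defs
begin

text \<open>
  Counting walks of length 3 shows that the canonical partition of \<open>G\<close> is equitable with a
  symmetric quotient matrix \<open>r\<close>. Counting edges and walks of length 2 gives the sum and the sum
  of squares of each row, and for \<open>n > 8\<close> these force the row to be a permutation of
  \<open>(1, n - 1, n - 1, n - 1)\<close>. By symmetry, the map sending a class to the one where the entry 1
  stands is an involution of the four classes. So the classes can be numbered such that this
  involution preserves \<open>{W\<^sub>1, W\<^sub>2}\<close>, and its three possible cycle types correspond
  to the three quotient matrices. Now \<open>W\<^sub>1 \<union> W\<^sub>2\<close> and \<open>W\<^sub>3 \<union> W\<^sub>4\<close> both induce \<open>n\<close>-regular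
  subgraphs, and \<open>H\<close> is \<open>G\<close> switched between them; switching twice gives back \<open>G\<close>.
\<close>

section \<open>Elementary facts on counting and switching\<close>

lemma card_Int_disjoint_Un:
  assumes "finite S" "X \<inter> Y = {}"
  shows "card (S \<inter> (X \<union> Y)) = card (S \<inter> X) + card (S \<inter> Y)"
  unfolding Int_Un_distrib by (rule card_Un_disjoint) (use assms in auto)

text \<open>Lets facts proved for a vertex of \<open>X\<close> be reused for a vertex of
  \<open>Y\<close>.\<close>

lemma switching_commute: "switching G X Y = switching G Y X"
  by (simp add: switching_def Un_commute)

lemma switching_switching: "switching (switching G X Y) X Y = G"
  by (cases G) (auto simp: switching_def)

section \<open>Double counting in a finite simple graph\<close>

context pair_graph
begin

lemma neighbours_sym: "y \<in> neighbours G x \<longleftrightarrow> x \<in> neighbours G y"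
  using pair_sym_arcs by (auto simp: neighbours_def symmetric_def dest: symD)

lemma neighbours_subset: "neighbours G x \<subseteq> pverts G"
  by (auto simp: neighbours_def dest: arc_snd_in_verts)

lemma finite_neighbours [simp]: "finite (neighbours G x)"
  by (rule finite_subset[OF neighbours_subset pair_finite_verts])

text \<open>Both sides count the walks of length 2 from \<open>x\<close> into \<open>T\<close>,
  sorted by end point on the left and by middle vertex on the right.\<close>

lemma sum_card_common_neighbours:
  assumes "finite T"
  shows "(\<Sum>y\<in>T. card (neighbours G x \<inter> neighbours G y))
    = (\<Sum>z\<in>neighbours G x. card (neighbours G z \<inter> T))"
proof -
  have "(\<Sum>y\<in>T. card {z \<in> neighbours G x. z \<in> neighbours G y})
      = (\<Sum>z\<in>neighbours G x. card (neighbours G z \<inter> T))"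
  proof (rule sum_multicount_gen, goal_cases)
    case 3
    have "{y \<in> T. z \<in> neighbours G y} = neighbours G z \<inter> T" for z
      using neighbours_sym by blast
    then show ?case by simp
  qed (use assms in auto)
  then show ?thesis by (simp add: Int_def)
qed

section \<open>Equitability and the row sums of the quotient matrix\<close>

context
  fixes k l1 l2 m n :: nat and P :: "'a set set"
  assumes regular: "\<forall>x\<in>pverts G. card (neighbours G x) = k"
    and canonical: "canonical_partition G l1 l2 m n P"
begin

lemma common_neighbours_same_class:
  "\<lbrakk>C \<in> P; x \<in> C; y \<in> C; x \<noteq> y\<rbrakk> \<Longrightarrow> card (neighbours G x \<inter> neighbours G y) = l1"
  using canonical by (simp add: canonical_partition_def)

lemma common_neighbours_diff_classes:
  "\<lbrakk>C \<in> P; D \<in> P; C \<noteq> D; x \<in> C; y \<in> D\<rbrakk> \<Longrightarrow> card (neighbours G x \<inter> neighbours G y) = l2"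
  using canonical by (simp add: canonical_partition_def)

lemma partition_on_classes: "partition_on (pverts G) P"
  using canonical by (simp add: canonical_partition_def)

lemma class_subset: "C \<in> P \<Longrightarrow> C \<subseteq> pverts G"
  using partition_onD1[OF partition_on_classes] by blast

lemma finite_class: "C \<in> P \<Longrightarrow> finite C"
  using class_subset pair_finite_verts finite_subset by blast

lemma finite_partition: "finite P"
  by (rule finite_elements[OF pair_finite_verts partition_on_classes])

text \<open>Entrywise form of \<open>A^2 = (k - l1) I + (l1 - l2) K + l2 J\<close>, with
  \<open>A\<close> the adjacency matrix and \<open>K\<close> the indicator of lying in the same
  class. Integers are used because \<open>l1 - l2\<close> may be negative.\<close>

lemma card_common_neighbours:
  assumes "D \<in> P" "y \<in> D" "z \<in> pverts G"
  shows "int (card (neighbours G z \<inter> neighbours G y))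
    = (if z = y then int k - int l1 else 0) + (if z \<in> D then int l1 - int l2 else 0) + int l2"
proof -
  from assms(3) partition_onD1[OF partition_on_classes] obtain C where "C \<in> P" "z \<in> C" by blast
  consider "z = y" | "z \<noteq> y" "z \<in> D" | "z \<notin> D" by blast
  then show ?thesis
  proof cases
    case 1
    then show ?thesis using assms(2) regular[rule_format, OF assms(3)] by simp
  next
    case 2
    then show ?thesis using common_neighbours_same_class[OF assms(1) _ assms(2)] by simp
  next
    case 3
    then have "C \<noteq> D" "z \<noteq> y" using \<open>z \<in> C\<close> assms(2) by auto
    then show ?thesis
      using common_neighbours_diff_classes[OF \<open>C \<in> P\<close> assms(1) _ \<open>z \<in> C\<close> assms(2)] 3 by simp
  qed
qed

text \<open>An entry of \<open>A^3 = A * A^2\<close>: the number of walks of length 3 from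
  \<open>x\<close> to \<open>y\<close>, found by summing \<open>card_common_neighbours\<close> over
  the neighbours of \<open>x\<close>.\<close>

lemma sum_card_common_neighbours_of_neighbours:
  assumes "D \<in> P" "x \<in> pverts G" "y \<in> D"
  shows "int (\<Sum>z\<in>neighbours G x. card (neighbours G z \<inter> neighbours G y))
    = (if y \<in> neighbours G x then int k - int l1 else 0)
      + (int l1 - int l2) * int (card (neighbours G x \<inter> D)) + int k * int l2"
proof -
  have "int (\<Sum>z\<in>neighbours G x. card (neighbours G z \<inter> neighbours G y))
     = (\<Sum>z\<in>neighbours G x. (if z = y then int k - int l1 else 0)
          + (if z \<in> D then int l1 - int l2 else 0) + int l2)"
    unfolding of_nat_sum
    by (intro sum.cong refl card_common_neighbours) (use assms neighbours_subset in auto)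
  also have "\<dots> = (\<Sum>z\<in>neighbours G x. if z = y then int k - int l1 else 0)
      + (\<Sum>z\<in>neighbours G x \<inter> D. int l1 - int l2) + (\<Sum>z\<in>neighbours G x. int l2)"
    by (simp add: sum.distrib flip: sum.inter_restrict)
  finally show ?thesis using regular[rule_format, OF assms(2)] by (simp add: mult.commute)
qed

text \<open>Count the walks of length 3 from \<open>x\<close> to \<open>y\<close> from either end.\<close>

lemma canonical_partition_equitable:
  assumes "l1 \<noteq> l2" "C \<in> P" "D \<in> P" "x \<in> C" "y \<in> D"
  shows "card (neighbours G x \<inter> D) = card (neighbours G y \<inter> C)"
proof -
  have V: "x \<in> pverts G" "y \<in> pverts G" using assms class_subset by auto
  have "(\<Sum>z\<in>neighbours G x. card (neighbours G z \<inter> neighbours G y))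
      = (\<Sum>z\<in>neighbours G y. card (neighbours G z \<inter> neighbours G x))"
    using sum_card_common_neighbours[of "neighbours G y" x] by (simp add: Int_commute)
  \<comment> \<open>The adjacency term is symmetric in \<open>x\<close> and \<open>y\<close> and the
    term \<open>int k * int l2\<close> is constant, so both cancel.\<close>
  then have "(int l1 - int l2) * int (card (neighbours G x \<inter> D))
      = (int l1 - int l2) * int (card (neighbours G y \<inter> C))"
    using sum_card_common_neighbours_of_neighbours[OF assms(3) V(1) assms(5)]
      sum_card_common_neighbours_of_neighbours[OF assms(2) V(2) assms(4)]
      neighbours_sym[of x y] by simp
  with assms(1) show ?thesis by simp
qed

lemma sum_over_classes:
  assumes "finite S" "S \<subseteq> pverts G"
  shows "(\<Sum>z\<in>S. f z) = (\<Sum>E\<in>P. \<Sum>z\<in>S \<inter> E. f z)"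
proof -
  have "S = (\<Union>E\<in>P. S \<inter> E)" using assms partition_onD1[OF partition_on_classes] by blast
  then have "(\<Sum>z\<in>S. f z) = (\<Sum>z\<in>(\<Union>E\<in>P. S \<inter> E). f z)" by simp
  also have "\<dots> = (\<Sum>E\<in>P. \<Sum>z\<in>S \<inter> E. f z)"
    using finite_partition assms(1) partition_onD2[OF partition_on_classes]
    by (intro sum.UNION_disjoint) (auto simp: disjoint_def)
  finally show ?thesis .
qed

lemma sum_quotient_row:
  assumes "x \<in> pverts G"
  shows "(\<Sum>E\<in>P. card (neighbours G x \<inter> E)) = k"
  using sum_over_classes[of "neighbours G x" "\<lambda>_. 1::nat"] neighbours_subset
    regular[rule_format, OF assms] by simp

text \<open>By equitability, a neighbour of \<open>x\<close> in \<open>E\<close> has as many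
  neighbours in \<open>C\<close> as \<open>x\<close> has in \<open>E\<close>, so each square counts
  the walks of length 2 from \<open>x\<close> through \<open>E\<close> back into \<open>C\<close>.
  Sorted by end point, \<open>k\<close> of these walks return to \<open>x\<close> and
  \<open>l1\<close> reach each other vertex of \<open>C\<close>.\<close>

lemma sum_quotient_row_square:
  assumes "l1 \<noteq> l2" "C \<in> P" "x \<in> C"
  shows "(\<Sum>E\<in>P. (card (neighbours G x \<inter> E))\<^sup>2) = k + (card C - 1) * l1"
proof -
  have fin: "finite C" and V: "x \<in> pverts G" using assms finite_class class_subset by auto
  have "(\<Sum>E\<in>P. (card (neighbours G x \<inter> E))\<^sup>2)
      = (\<Sum>E\<in>P. \<Sum>z\<in>neighbours G x \<inter> E. card (neighbours G z \<inter> C))"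
  proof (rule sum.cong[OF refl])
    fix E assume E: "E \<in> P"
    have "card (neighbours G z \<inter> C) = card (neighbours G x \<inter> E)" if "z \<in> neighbours G x \<inter> E" for z
      using canonical_partition_equitable[OF assms(1) E assms(2) _ assms(3)] that by blast
    then show "(card (neighbours G x \<inter> E))\<^sup>2 = (\<Sum>z\<in>neighbours G x \<inter> E. card (neighbours G z \<inter> C))"
      by (simp add: power2_eq_square)
  qed
  also have "\<dots> = (\<Sum>z\<in>neighbours G x. card (neighbours G z \<inter> C))"
    by (rule sum_over_classes[OF finite_neighbours neighbours_subset, symmetric])
  also have "\<dots> = (\<Sum>y\<in>C. card (neighbours G x \<inter> neighbours G y))"
    using sum_card_common_neighbours[OF fin] by simp
  also have "\<dots> = k + (\<Sum>y\<in>C - {x}. card (neighbours G x \<inter> neighbours G y))"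
    using regular[rule_format, OF V] by (simp add: sum.remove[OF fin assms(3)])
  also have "(\<Sum>y\<in>C - {x}. card (neighbours G x \<inter> neighbours G y)) = (\<Sum>y\<in>C - {x}. l1)"
    by (intro sum.cong refl common_neighbours_same_class[OF assms(2,3)]) auto
  finally show ?thesis using fin assms(3) by simp
qed

end

section \<open>Effect of switching on neighbourhoods\<close>

lemma pair_graph_switching:
  assumes "X \<subseteq> pverts G" "Y \<subseteq> pverts G" "X \<inter> Y = {}"
  shows "pair_graph (switching G X Y)"
proof -
  have arcs: "fst e \<in> pverts G \<and> snd e \<in> pverts G \<and> fst e \<noteq> snd e"
    if "e \<in> parcs (switching G X Y)" for e
  proof -
    from that have "e \<in> parcs G \<or> e \<in> X \<times> Y \<or> e \<in> Y \<times> X"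
      by (auto simp: switching_def)
    then show ?thesis
      using assms arc_fst_in_verts[of e] arc_snd_in_verts[of e] pair_no_loops[of e] by auto
  qed
  have verts: "pverts (switching G X Y) = pverts G" by (simp add: switching_def)
  show ?thesis
  proof
    show "finite (pverts (switching G X Y))" using pair_finite_verts by (simp add: verts)
    show "finite (parcs (switching G X Y))"
      using pair_finite_arcs assms(1,2)[THEN finite_subset, OF pair_finite_verts]
      by (simp add: switching_def)
    show "symmetric (with_proj (switching G X Y))"
      using pair_sym_arcs by (auto simp: symmetric_def switching_def sym_def)
  qed (simp_all add: arcs verts)
qed

lemma neighbours_switching:
  assumes "pverts G = X \<union> Y" "X \<inter> Y = {}" "x \<in> X"
  shows "neighbours (switching G X Y) x = (neighbours G x \<inter> X) \<union> (Y - neighbours G x)"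
proof -
  have "x \<notin> Y" using assms by auto
  then show ?thesis
    using assms neighbours_subset[of x] by (auto simp: neighbours_def switching_def)
qed

text \<open>Common neighbours in \<open>X\<close> stay; in \<open>Y\<close> they become the vertices
  adjacent to neither \<open>x\<close> nor \<open>y\<close>, counted by inclusion-exclusion. The
  additive form avoids truncated subtraction.\<close>

lemma common_neighbours_switching_same_side:
  assumes V: "pverts G = X \<union> Y" "X \<inter> Y = {}" and "x \<in> X" "y \<in> X"
  shows "card (neighbours (switching G X Y) x \<inter> neighbours (switching G X Y) y)
      + card (neighbours G x \<inter> Y) + card (neighbours G y \<inter> Y)
    = card (neighbours G x \<inter> neighbours G y) + card Y"
proof -
  let ?N = "neighbours G"
  have fin: "finite X" "finite Y" using pair_finite_verts V by auto
  have s: "neighbours (switching G X Y) x \<inter> neighbours (switching G X Y) y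
      = (?N x \<inter> ?N y \<inter> X) \<union> (Y - (?N x \<union> ?N y) \<inter> Y)"
    using V(2) by (auto simp: neighbours_switching[OF V assms(3)] neighbours_switching[OF V assms(4)])
  have "card (neighbours (switching G X Y) x \<inter> neighbours (switching G X Y) y)
      = card (?N x \<inter> ?N y \<inter> X) + card (Y - (?N x \<union> ?N y) \<inter> Y)"
    unfolding s by (rule card_Un_disjoint) (use V fin in auto)
  moreover have "card (Y - (?N x \<union> ?N y) \<inter> Y) + card ((?N x \<union> ?N y) \<inter> Y) = card Y"
    using fin by (simp add: card_Diff_subset card_mono)
  moreover have "card (?N x \<inter> Y) + card (?N y \<inter> Y)
      = card ((?N x \<union> ?N y) \<inter> Y) + card (?N x \<inter> ?N y \<inter> Y)"
    using card_Un_Int[of "?N x \<inter> Y" "?N y \<inter> Y"] by (simp add: Int_Un_distrib Int_ac)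
  moreover have "card (?N x \<inter> ?N y) = card (?N x \<inter> ?N y \<inter> X) + card (?N x \<inter> ?N y \<inter> Y)"
    using card_Int_disjoint_Un[OF _ V(2), of "?N x \<inter> ?N y"] neighbours_subset V(1)
    by (simp add: Int_absorb2 le_infI1)
  ultimately show ?thesis by linarith
qed

text \<open>After switching, the common neighbours in \<open>X\<close> are the neighbours of
  \<open>x\<close> that were not adjacent to \<open>y\<close>, and those in \<open>Y\<close> are the
  neighbours of \<open>y\<close> that were not adjacent to \<open>x\<close>.\<close>

lemma common_neighbours_switching_diff_sides:
  assumes V: "pverts G = X \<union> Y" "X \<inter> Y = {}" and "x \<in> X" "y \<in> Y"
  shows "card (neighbours (switching G X Y) x \<inter> neighbours (switching G X Y) y)
      + card (neighbours G x \<inter> neighbours G y)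
    = card (neighbours G x \<inter> X) + card (neighbours G y \<inter> Y)"
proof -
  let ?N = "neighbours G"
  have fin: "finite X" "finite Y" using pair_finite_verts V by auto
  have V': "pverts G = Y \<union> X" "Y \<inter> X = {}" using V by auto
  have s: "neighbours (switching G X Y) x \<inter> neighbours (switching G X Y) y
      = (?N x \<inter> X - ?N y) \<union> (?N y \<inter> Y - ?N x)"
    using V(2) neighbours_switching[OF V' assms(4)]
    by (auto simp: neighbours_switching[OF V assms(3)] switching_commute[of G Y X])
  have "card (neighbours (switching G X Y) x \<inter> neighbours (switching G X Y) y)
      = card (?N x \<inter> X - ?N y) + card (?N y \<inter> Y - ?N x)"
    unfolding s by (rule card_Un_disjoint) (use V fin in auto)
  moreover have "card (?N x \<inter> X) = card (?N x \<inter> X - ?N y) + card (?N x \<inter> ?N y \<inter> X)"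
    using card_Int_Diff[of "?N x \<inter> X" "?N y"] by (simp add: Int_ac)
  moreover have "card (?N y \<inter> Y) = card (?N y \<inter> Y - ?N x) + card (?N x \<inter> ?N y \<inter> Y)"
    using card_Int_Diff[of "?N y \<inter> Y" "?N x"] by (simp add: Int_ac)
  moreover have "card (?N x \<inter> ?N y) = card (?N x \<inter> ?N y \<inter> X) + card (?N x \<inter> ?N y \<inter> Y)"
    using card_Int_disjoint_Un[OF _ V(2), of "?N x \<inter> ?N y"] neighbours_subset V(1)
    by (simp add: Int_absorb2 le_infI1)
  ultimately show ?thesis by linarith
qed

lemma card_neighbours_switching:
  assumes V: "pverts G = X \<union> Y" "X \<inter> Y = {}" and x: "x \<in> X"
  shows "W \<subseteq> X \<Longrightarrow> card (neighbours (switching G X Y) x \<inter> W) = card (neighbours G x \<inter> W)"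
    and "W \<subseteq> Y \<Longrightarrow> card (neighbours (switching G X Y) x \<inter> W) = card W - card (neighbours G x \<inter> W)"
proof -
  note N = neighbours_switching[OF V x]
  show "card (neighbours (switching G X Y) x \<inter> W) = card (neighbours G x \<inter> W)" if "W \<subseteq> X"
    by (rule arg_cong[of _ _ card]) (use that V in \<open>auto simp: N\<close>)
  assume "W \<subseteq> Y"
  then have "neighbours (switching G X Y) x \<inter> W = W - neighbours G x \<inter> W"
    using V by (auto simp: N)
  then show "card (neighbours (switching G X Y) x \<inter> W) = card W - card (neighbours G x \<inter> W)"
    by (simp add: card_Diff_subset)
qed

end

section \<open>Possible rows of the quotient matrix\<close>

lemma sum_squares_le_square_sum:
  fixes s :: "'b \<Rightarrow> 'c::linordered_semidom"
  assumes "finite Q" "\<And>E. E \<in> Q \<Longrightarrow> 0 \<le> s E"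
  shows "(\<Sum>E\<in>Q. (s E)\<^sup>2) \<le> (\<Sum>E\<in>Q. s E)\<^sup>2"
proof -
  have "(\<Sum>E\<in>Q. s E * s E) \<le> (\<Sum>E\<in>Q. s E * (\<Sum>E\<in>Q. s E))"
    using assms by (intro sum_mono mult_left_mono member_le_sum) auto
  then show ?thesis by (simp add: power2_eq_square sum_distrib_right)
qed

text \<open>In terms of the deficiencies \<open>s = n - r\<close>, the largest \<open>s\<close> is at least the ratio
  of \<open>\<Sum>s\<^sup>2\<close> and \<open>\<Sum>s\<close>, hence at least \<open>n - 3\<close>. For \<open>n > 8\<close> only \<open>n - 1\<close> survives,
  because the squares of the other three cannot exceed the square of their sum.\<close>

lemma quotient_row_cases:
  fixes r :: "'b \<Rightarrow> nat"
  assumes "card P = 4" "n > 8" "\<And>E. E \<in> P \<Longrightarrow> r E \<le> n"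
    and s1: "(\<Sum>E\<in>P. r E) = 3 * n - 2"
    and s2: "(\<Sum>E\<in>P. (r E)\<^sup>2) = (3 * n - 2) + (n - 1) * (3 * n - 6)"
  obtains A where "A \<in> P" "r A = 1" "\<And>E. E \<in> P \<Longrightarrow> E \<noteq> A \<Longrightarrow> r E = n - 1"
proof -
  define s where "s E = int n - int (r E)" for E
  define N where "N = int n"
  have N: "N > 8" using assms(2) by (simp add: N_def)
  have fin: "finite P" using assms(1) by (simp add: card_ge_0_finite)
  have s0: "0 \<le> s E" "s E \<le> N" if "E \<in> P" for E using assms(3)[OF that] by (auto simp: s_def N_def)
  have S1: "(\<Sum>E\<in>P. int (r E)) = 3 * N - 2"
    using arg_cong[OF s1, of int] N by (simp add: N_def of_nat_diff)
  have S2: "(\<Sum>E\<in>P. (int (r E))\<^sup>2) = 3 * N - 2 + (N - 1) * (3 * N - 6)"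
    using arg_cong[OF s2, of int] N by (simp add: N_def of_nat_diff)
  have T1: "(\<Sum>E\<in>P. s E) = N + 2"
    using S1 assms(1) by (simp add: s_def sum_subtractf N_def)
  have "(\<Sum>E\<in>P. (s E)\<^sup>2) = (\<Sum>E\<in>P. N\<^sup>2 - 2 * N * int (r E) + (int (r E))\<^sup>2)"
    by (simp add: s_def N_def power2_diff mult.assoc algebra_simps)
  also have "\<dots> = 4 * N\<^sup>2 - 2 * N * (3 * N - 2) + (3 * N - 2 + (N - 1) * (3 * N - 6))"
    using assms(1) S1 S2 by (simp add: sum.distrib sum_subtractf flip: sum_distrib_left)
  finally have T2: "(\<Sum>E\<in>P. (s E)\<^sup>2) = N\<^sup>2 - 2 * N + 4"
    by (simp add: algebra_simps power2_eq_square)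
  obtain A where A: "A \<in> P" "\<And>E. E \<in> P \<Longrightarrow> s E \<le> s A"
  proof -
    have "Max (s ` P) \<in> s ` P" by (rule Max_in) (use fin assms(1) in auto)
    then obtain A where "A \<in> P" "Max (s ` P) = s A" by auto
    moreover have "s E \<le> Max (s ` P)" if "E \<in> P" for E using that fin by simp
    ultimately show ?thesis using that by metis
  qed
  define d where "d = N - s A"
  have "(\<Sum>E\<in>P. (s E)\<^sup>2) \<le> (\<Sum>E\<in>P. s A * s E)"
    by (intro sum_mono) (simp add: power2_eq_square mult_right_mono A s0)
  then have "N\<^sup>2 - 2 * N + 4 \<le> (N - d) * (N + 2)"
    by (simp add: T1 T2 d_def flip: sum_distrib_left)
  \<comment> \<open>Rearranging gives the stronger bound
    \<open>(d - 4) * (N + 2) \<le> -12\<close>.\<close>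
  then have "(d - 4) * (N + 2) < 0" by (simp add: algebra_simps power2_eq_square)
  then have "d < 4" using N by (simp add: mult_less_0_iff)
  moreover have "d \<ge> 0" using s0[OF A(1)] by (simp add: d_def)
  ultimately have d: "d = 0 \<or> d = 1 \<or> d = 2 \<or> d = 3" by linarith
  define Q where "Q = P - {A}"
  have Q: "finite Q" "card Q = 3" using fin assms(1) A by (auto simp: Q_def)
  have U1: "(\<Sum>E\<in>Q. s E) = d + 2"
    using T1 sum.remove[OF fin A(1), of s] by (simp add: Q_def d_def)
  have U2: "(\<Sum>E\<in>Q. (s E)\<^sup>2) = 2 * N * (d - 1) + 4 - d\<^sup>2"
    using T2 sum.remove[OF fin A(1), of "\<lambda>E. (s E)\<^sup>2"]
    by (simp add: Q_def d_def algebra_simps power2_eq_square)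
  have U0: "0 \<le> (\<Sum>E\<in>Q. (s E)\<^sup>2)" by (simp add: sum_nonneg)
  have "(\<Sum>E\<in>Q. (s E)\<^sup>2) \<le> (\<Sum>E\<in>Q. s E)\<^sup>2"
    by (rule sum_squares_le_square_sum) (use Q s0 in \<open>auto simp: Q_def\<close>)
  \<comment> \<open>For \<open>d = 0\<close> the sum of squares \<open>4 - 2 * N\<close> is
    negative. For \<open>d = 2\<close> and \<open>d = 3\<close> the bound reads
    \<open>2 * N \<le> 16\<close> and \<open>4 * N - 5 \<le> 25\<close>; the former is where
    \<open>N > 8\<close> is sharp.\<close>
  with d N U0 have d1: "d = 1" unfolding U1 U2 by auto
  \<comment> \<open>The three remaining deficiencies have sum 3 and sum of squares 3, so their
    deviation from the mean 1 vanishes.\<close>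
  have "(\<Sum>E\<in>Q. (s E - 1)\<^sup>2) = (\<Sum>E\<in>Q. (s E)\<^sup>2) - 2 * (\<Sum>E\<in>Q. s E) + 3"
    using Q by (simp add: power2_diff sum.distrib sum_subtractf sum_distrib_left)
  also have "\<dots> = 0" using U1 U2 d1 by simp
  finally have "\<forall>E\<in>Q. s E = 1" using Q by (simp add: sum_nonneg_eq_0_iff)
  then have "r E = n - 1" if "E \<in> P" "E \<noteq> A" for E
  proof -
    have "s E = 1" using \<open>\<forall>E\<in>Q. s E = 1\<close> that by (simp add: Q_def)
    then show ?thesis unfolding s_def by linarith
  qed
  moreover have "r A = 1" using d1 by (simp add: d_def s_def N_def)
  ultimately show ?thesis using that A(1) by blast
qed

text \<open>A 2-cycle, if there is one, is placed last; the other two elements are then both fixed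
  or swapped. Hence the first two and the last two elements always form \<open>f\<close>-invariant
  pairs.\<close>

lemma involution_card_4:
  assumes "card P = 4" "\<And>C. C \<in> P \<Longrightarrow> f C \<in> P" "\<And>C. C \<in> P \<Longrightarrow> f (f C) = C"
  obtains A B C D where "P = {A, B, C, D}" "distinct [A, B, C, D]"
    "f A = A \<and> f B = B \<and> f C = C \<and> f D = D \<or>
     f A = A \<and> f B = B \<and> f C = D \<and> f D = C \<or>
     f A = B \<and> f B = A \<and> f C = D \<and> f D = C"
proof (cases "\<exists>C\<in>P. f C \<noteq> C")
  case True
  then obtain C where C: "C \<in> P" "f C \<noteq> C" by blast
  have fin: "finite P" using assms(1) by (simp add: card_ge_0_finite)
  have "card (P - {C, f C}) = 2"
    using C assms fin by (simp add: card_Diff_subset)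
  then obtain A B where AB: "P - {C, f C} = {A, B}" "A \<noteq> B" by (auto simp: card_2_iff)
  have P: "P = {A, B, C, f C}" using AB(1) C assms(2) by blast
  have ne: "A \<noteq> C" "A \<noteq> f C" "B \<noteq> C" "B \<noteq> f C" using AB(1) by auto
  \<comment> \<open>If \<open>f\<close> sent \<open>A\<close> or \<open>B\<close> into the invariant
    pair \<open>{C, f C}\<close>, applying \<open>f\<close> again would put that element there
    too.\<close>
  have "f A \<in> {A, B}" "f B \<in> {A, B}"
    using P ne assms(2)[of A] assms(2)[of B] assms(3)[of A] assms(3)[of B] assms(3)[of C] by auto
  then have "f A = A \<and> f B = B \<or> f A = B \<and> f B = A"
    using assms(3)[of A] assms(3)[of B] P AB(2) by auto
  then show ?thesis
    using that[of A B C "f C"] P ne AB(2) C assms(3)[of C] by auto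
next
  case False
  obtain A B C D where "P = {A, B, C, D}" "distinct [A, B, C, D]"
    using assms(1) by (auto simp: card_Suc_eq numeral_eq_Suc)
  with False that show ?thesis by blast
qed

section \<open>Parameters of the switched graph\<close>

lemma (in pair_graph) divisible_design_graph_switching:
  assumes canonical: "canonical_partition G (3 * n - 6) (2 * n - 2) m n P" and "n \<ge> 2"
    and V: "pverts G = X \<union> Y" "X \<inter> Y = {}"
    and split: "\<And>W. W \<in> P \<Longrightarrow> W \<subseteq> X \<or> W \<subseteq> Y"
    and card: "card X = 2 * n" "card Y = 2 * n"
    and X: "\<And>x. x \<in> X \<Longrightarrow> card (neighbours G x \<inter> X) = n"
      "\<And>x. x \<in> X \<Longrightarrow> card (neighbours G x \<inter> Y) = 2 * n - 2"
    and Y: "\<And>y. y \<in> Y \<Longrightarrow> card (neighbours G y \<inter> Y) = n"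
      "\<And>y. y \<in> Y \<Longrightarrow> card (neighbours G y \<inter> X) = 2 * n - 2"
  shows "canonical_partition (switching G X Y) (n - 2) 2 m n P \<and>
    divisible_design_graph (switching G X Y) (m * n) (n + 2) (n - 2) 2 m n"
proof -
  let ?N = "neighbours G" and ?H = "switching G X Y"
  have fin: "finite X" "finite Y" using pair_finite_verts V by auto
  have V': "pverts G = Y \<union> X" "Y \<inter> X = {}" using V by auto
  have H: "pair_graph ?H" by (rule pair_graph_switching) (use V in auto)
  have verts: "pverts ?H = pverts G" by (simp add: switching_def)
  \<comment> \<open>Two vertices on one side have \<open>2 * (2 * n - 2)\<close> adjacencies to the
    other side, which has \<open>2 * n\<close> vertices. So \<open>3 * n - 6\<close> becomes
    \<open>n - 2\<close> and \<open>2 * n - 2\<close> becomes 2.\<close>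
  have same: "card (neighbours ?H x \<inter> neighbours ?H y) + 2 * n = card (?N x \<inter> ?N y) + 4"
    if "x \<in> X \<and> y \<in> X \<or> x \<in> Y \<and> y \<in> Y" for x y
    using that
  proof
    assume "x \<in> X \<and> y \<in> X"
    with common_neighbours_switching_same_side[OF V, of x y] X card(2) \<open>n \<ge> 2\<close> show ?thesis by auto
  next
    assume "x \<in> Y \<and> y \<in> Y"
    with common_neighbours_switching_same_side[OF V', of x y] Y card(1) \<open>n \<ge> 2\<close> show ?thesis
      by (auto simp: switching_commute[of G X Y])
  qed
  have diff: "card (neighbours ?H x \<inter> neighbours ?H y) + card (?N x \<inter> ?N y) = 2 * n"
    if "x \<in> X \<and> y \<in> Y \<or> x \<in> Y \<and> y \<in> X" for x y
    using that common_neighbours_switching_diff_sides[OF V, of x y]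
      common_neighbours_switching_diff_sides[OF V, of y x] X Y
    by (auto simp: Int_commute)
  have C1: "card (neighbours ?H x \<inter> neighbours ?H y) = n - 2"
    if "C \<in> P" "x \<in> C" "y \<in> C" "x \<noteq> y" for C x y
  proof -
    have "card (?N x \<inter> ?N y) = 3 * n - 6"
      using canonical that by (simp add: canonical_partition_def)
    moreover have "x \<in> X \<and> y \<in> X \<or> x \<in> Y \<and> y \<in> Y" using split that by blast
    note same[OF this]
    ultimately show ?thesis using \<open>n \<ge> 2\<close> by linarith
  qed
  have C2: "card (neighbours ?H x \<inter> neighbours ?H y) = 2"
    if "C \<in> P" "D \<in> P" "C \<noteq> D" "x \<in> C" "y \<in> D" for C D x y
  proof -
    have c: "card (?N x \<inter> ?N y) = 2 * n - 2"
      using canonical that by (simp add: canonical_partition_def)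
    have "x \<in> X \<union> Y" "y \<in> X \<union> Y" using split that by blast+
    then consider "x \<in> X \<and> y \<in> X \<or> x \<in> Y \<and> y \<in> Y" | "x \<in> X \<and> y \<in> Y \<or> x \<in> Y \<and> y \<in> X"
      by blast
    then show ?thesis
    proof cases
      case 1 with same[OF 1] c \<open>n \<ge> 2\<close> show ?thesis by linarith
    next
      case 2 with diff[OF 2] c \<open>n \<ge> 2\<close> show ?thesis by linarith
    qed
  qed
  \<comment> \<open>Kept as a separate conclusion because \<open>divisible_design_graph\<close>
    hides the partition, while the quotient matrix refers to this \<open>P\<close>.\<close>
  have can: "canonical_partition ?H (n - 2) 2 m n P"
    unfolding canonical_partition_def
  proof (intro conjI ballI impI)
    show "partition_on (pverts ?H) P" "card P = m"
      using canonical by (auto simp: canonical_partition_def verts)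
    show "card C = n" if "C \<in> P" for C
      using canonical that by (auto simp: canonical_partition_def)
  qed (fact C1 C2)+
  \<comment> \<open>A vertex keeps \<open>n\<close> neighbours on its own side and gets
    \<open>2 * n - (2 * n - 2) = 2\<close> on the other.\<close>
  have deg: "card (neighbours ?H x) = n + 2" if "x \<in> pverts G" for x
  proof -
    have s: "card (neighbours ?H x) = card (neighbours ?H x \<inter> X) + card (neighbours ?H x \<inter> Y)"
      using card_Int_disjoint_Un[OF pair_graph.finite_neighbours[OF H, of x] V(2)]
        pair_graph.neighbours_subset[OF H, of x] verts V(1) by (simp add: Int_absorb2)
    show ?thesis
    proof (cases "x \<in> X")
      case True
      then show ?thesis
        using s card_neighbours_switching[OF V True] X[OF True] card \<open>n \<ge> 2\<close> by simp
    next
      case False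
      then have x: "x \<in> Y" using that V by auto
      then show ?thesis
        using s card_neighbours_switching[OF V' x] Y[OF x] card \<open>n \<ge> 2\<close>
        by (simp add: switching_commute[of G X Y])
    qed
  qed
  have "card (pverts G) = (\<Sum>C\<in>P. card C)"
  proof (rule product_partition)
    show "partition_on (pverts G) P" using canonical by (simp add: canonical_partition_def)
    show "finite C" if "C \<in> P" for C using split[OF that] fin finite_subset by blast
  qed
  also have "\<dots> = m * n" using canonical by (simp add: canonical_partition_def)
  finally show ?thesis
    using H can deg verts unfolding divisible_design_graph_def by auto
qed

lemma (in wf_digraph) digraph_iso_refl: "digraph_iso G G"
  unfolding digraph_iso_def
proof (intro exI conjI)
  let ?id = "\<lparr>iso_verts = id, iso_arcs = id, iso_head = head G, iso_tail = tail G\<rparr>"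
  show "digraph_isomorphism ?id"
    by (simp add: digraph_isomorphism_def wf_digraph_axioms)
  show "G = app_iso ?id G"
    by (simp add: app_iso_def)
qed

section \<open>Numbering the classes and identifying the quotient matrix\<close>

theorem theorem2:
  fixes G :: "'a pair_pre_digraph" and n :: nat
  assumes "n > 8"
    and "divisible_design_graph G (4 * n) (3 * n - 2) (3 * n - 6) (2 * n - 2) 4 n"
  shows "\<exists>(H :: 'a pair_pre_digraph) P Ws.
    divisible_design_graph H (4 * n) (n + 2) (n - 2) 2 4 n \<and>
    canonical_partition H (n - 2) 2 4 n P \<and>
    numbering_of Ws P \<and>
    (\<exists>R \<in> {mat_of_rows_list 4
             [[n - 1, 1, 1, 1],
              [1, n - 1, 1, 1],
              [1, 1, n - 1, 1],
              [1, 1, 1, n - 1]],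
           mat_of_rows_list 4
             [[1, n - 1, 1, 1],
              [n - 1, 1, 1, 1],
              [1, 1, n - 1, 1],
              [1, 1, 1, n - 1]],
           mat_of_rows_list 4
             [[1, n - 1, 1, 1],
              [n - 1, 1, 1, 1],
              [1, 1, 1, n - 1],
              [1, 1, n - 1, 1]]}.
       has_quotient_matrix H Ws R) \<and>
    digraph_iso (with_proj G)
      (with_proj (switching H (Ws ! 0 \<union> Ws ! 1) (Ws ! 2 \<union> Ws ! 3)))"
proof -
  from assms(2) interpret pair_graph G by (simp add: divisible_design_graph_def)
  let ?N = "neighbours G"
  have reg: "\<forall>x\<in>pverts G. card (?N x) = 3 * n - 2"
    using assms(2) by (simp add: divisible_design_graph_def)
  obtain P where can: "canonical_partition G (3 * n - 6) (2 * n - 2) 4 n P"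
    using assms(2) by (auto simp: divisible_design_graph_def)
  then have P: "partition_on (pverts G) P" "card P = 4" and cardn: "\<And>C. C \<in> P \<Longrightarrow> card C = n"
    by (auto simp: canonical_partition_def)
  \<comment> \<open>Equitability needs distinct parameters; for \<open>n \<ge> 2\<close> these
    coincide only at \<open>n = 4\<close>.\<close>
  have lam: "3 * n - 6 \<noteq> 2 * n - 2" using assms(1) by simp
  note equitable = canonical_partition_equitable[OF reg can lam]
  define rep where "rep C = (SOME x. x \<in> C)" for C :: "'a set"
  define r where "r C D = card (?N (rep C) \<inter> D)" for C D
  have rep: "rep C \<in> C" if "C \<in> P" for C
  proof -
    have "C \<noteq> {}" using partition_onD3[OF P(1)] that by auto
    then show ?thesis unfolding rep_def by (rule some_in_eq[THEN iffD2])
  qed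
  \<comment> \<open>Independence of the representative: \<open>x\<close> and \<open>rep C\<close>
    are both compared with \<open>rep D\<close>.\<close>
  have r: "card (?N x \<inter> D) = r C D" if "C \<in> P" "D \<in> P" "x \<in> C" for C D x
    using that equitable[OF that(1,2,3) rep[OF that(2)]]
      equitable[OF that(1,2) rep[OF that(1)] rep[OF that(2)]] by (simp add: r_def)
  have r_sym: "r C D = r D C" if "C \<in> P" "D \<in> P" for C D
    using equitable[OF that rep[OF that(1)] rep[OF that(2)]] by (simp add: r_def)
  have "\<forall>C\<in>P. \<exists>A. A \<in> P \<and> r C A = 1 \<and> (\<forall>E\<in>P. E \<noteq> A \<longrightarrow> r C E = n - 1)"
  proof
    fix C assume C: "C \<in> P"
    have V: "rep C \<in> pverts G" using rep[OF C] C partition_onD1[OF P(1)] by blast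
    show "\<exists>A. A \<in> P \<and> r C A = 1 \<and> (\<forall>E\<in>P. E \<noteq> A \<longrightarrow> r C E = n - 1)"
    proof (rule quotient_row_cases[OF P(2) assms(1), of "r C"])
      show "r C E \<le> n" if "E \<in> P" for E
        unfolding r_def cardn[OF that, symmetric]
        by (rule card_mono) (use finite_class[OF reg can that] in auto)
      show "(\<Sum>E\<in>P. r C E) = 3 * n - 2"
        using sum_quotient_row[OF reg can V] by (simp add: r_def)
      show "(\<Sum>E\<in>P. (r C E)\<^sup>2) = 3 * n - 2 + (n - 1) * (3 * n - 6)"
        using sum_quotient_row_square[OF reg can lam C rep[OF C]] cardn[OF C] by (simp add: r_def)
    qed blast
  qed
  then obtain f where "\<forall>C\<in>P. f C \<in> P \<and> r C (f C) = 1 \<and> (\<forall>E\<in>P. E \<noteq> f C \<longrightarrow> r C E = n - 1)"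
    by metis
  then have f: "f C \<in> P" "E \<in> P \<Longrightarrow> r C E = (if E = f C then 1 else n - 1)" if "C \<in> P" for C E
    using that by auto
  have inv: "f (f C) = C" if "C \<in> P" for C
  proof (rule ccontr)
    assume "f (f C) \<noteq> C"
    then have "r (f C) C = n - 1" "r C (f C) = 1" using f that by auto
    then show False using r_sym[OF that f(1)[OF that]] assms(1) by simp
  qed
  obtain A B C D where ABCD: "P = {A, B, C, D}" "distinct [A, B, C, D]"
    and fcases: "f A = A \<and> f B = B \<and> f C = C \<and> f D = D \<or>
      f A = A \<and> f B = B \<and> f C = D \<and> f D = C \<or>
      f A = B \<and> f B = A \<and> f C = D \<and> f D = C"
  proof (rule involution_card_4[OF P(2), of f])
    show "f C \<in> P" "f (f C) = C" if "C \<in> P" for C using f(1) inv that by auto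
  qed (rule that)
  define X where "X = A \<union> B"
  define Y where "Y = C \<union> D"
  have disj: "U \<inter> W = {}" if "U \<in> P" "W \<in> P" "U \<noteq> W" for U W
    using partition_onD2[OF P(1)] that by (auto simp: disjoint_def)
  have inP: "A \<in> P" "B \<in> P" "C \<in> P" "D \<in> P"
    and ne: "A \<noteq> B" "A \<noteq> C" "A \<noteq> D" "B \<noteq> C" "B \<noteq> D" "C \<noteq> D"
    using ABCD by simp_all
  have fin: "finite W" if "W \<in> P" for W using finite_class[OF reg can that] .
  have V: "pverts G = X \<union> Y" using partition_onD1[OF P(1)] ABCD(1) by (auto simp: X_def Y_def)
  have XY: "X \<inter> Y = {}"
    unfolding X_def Y_def Int_Un_distrib Int_Un_distrib2 by (simp add: disj inP ne)
  have AB: "A \<inter> B = {}" and CD: "C \<inter> D = {}" using disj inP ne by auto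
  have cX: "card (S \<inter> X) = card (S \<inter> A) + card (S \<inter> B)"
    and cY: "card (S \<inter> Y) = card (S \<inter> C) + card (S \<inter> D)" if "finite S" for S
    using that card_Int_disjoint_Un AB CD by (auto simp: X_def Y_def)
  let ?H = "switching G X Y"
  have H: "canonical_partition ?H (n - 2) 2 4 n P \<and>
    divisible_design_graph ?H (4 * n) (n + 2) (n - 2) 2 4 n"
  proof (rule divisible_design_graph_switching[OF can _ V XY])
    show "card X = 2 * n" "card Y = 2 * n"
      unfolding X_def Y_def using card_Un_disjoint[OF _ _ AB] card_Un_disjoint[OF _ _ CD]
      by (simp_all add: cardn fin inP)
    \<comment> \<open>Both pairs are invariant under \<open>f\<close>, so the entry 1 of each row
      lies on the side of \<open>U\<close>: that side sums to \<open>1 + (n - 1)\<close>, the other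
      to \<open>2 * (n - 1)\<close>.\<close>
    have n: "r U A + r U B = (if U \<in> {A, B} then n else 2 * n - 2)"
      "r U C + r U D = (if U \<in> {A, B} then 2 * n - 2 else n)" if "U \<in> P" for U
    proof -
      from that ABCD(1) consider "U = A" | "U = B" | "U = C" | "U = D" by blast
      then show "r U A + r U B = (if U \<in> {A, B} then n else 2 * n - 2)"
        "r U C + r U D = (if U \<in> {A, B} then 2 * n - 2 else n)"
        using fcases assms(1) by (cases; elim disjE; simp add: f inP ne ne[symmetric])+
    qed
    show "card (?N x \<inter> X) = n" "card (?N x \<inter> Y) = 2 * n - 2" if "x \<in> X" for x
    proof -
      from that obtain U where U: "U \<in> {A, B}" "x \<in> U" "U \<in> P" using inP by (auto simp: X_def)
      then show "card (?N x \<inter> X) = n" "card (?N x \<inter> Y) = 2 * n - 2"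
        using n[OF U(3)] by (simp_all add: cX cY r[OF U(3) _ U(2)] inP)
    qed
    show "card (?N x \<inter> Y) = n" "card (?N x \<inter> X) = 2 * n - 2" if "x \<in> Y" for x
    proof -
      from that obtain U where U: "U \<notin> {A, B}" "x \<in> U" "U \<in> P" using inP ne by (auto simp: Y_def)
      then show "card (?N x \<inter> Y) = n" "card (?N x \<inter> X) = 2 * n - 2"
        using n[OF U(3)] by (simp_all add: cX cY r[OF U(3) _ U(2)] inP)
    qed
    show "W \<subseteq> X \<or> W \<subseteq> Y" if "W \<in> P" for W
      using that ABCD(1) by (auto simp: X_def Y_def)
  qed (use assms(1) in simp_all)
  define Ws where "Ws = [A, B, C, D]"
  \<comment> \<open>Indices below 2 belong to \<open>X\<close>. Diagonal blocks are unchanged; in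
    the other blocks complementation turns \<open>n - 1\<close> into 1.\<close>
  define R where "R = mat 4 4 (\<lambda>(i, j).
    if (i < 2) = (j < 2) then r (Ws ! i) (Ws ! j) else n - r (Ws ! i) (Ws ! j))"
  have num: "numbering_of Ws P" using ABCD by (simp add: numbering_of_def Ws_def)
  have q: "card (neighbours ?H x \<inter> W) = (if (U \<subseteq> X) = (W \<subseteq> X) then r U W else n - r U W)"
    if "U \<in> P" "W \<in> P" "x \<in> U" for U W x
  proof -
    \<comment> \<open>Classes are nonempty, so inclusion in \<open>X\<close> decides the
      side.\<close>
    have split: "U \<subseteq> X \<and> \<not> U \<subseteq> Y \<or> U \<subseteq> Y \<and> \<not> U \<subseteq> X" if "U \<in> P" for U
    proof -
      have "U \<subseteq> X \<or> U \<subseteq> Y" using that ABCD(1) by (auto simp: X_def Y_def)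
      with XY rep[OF that] show ?thesis by blast
    qed
    have V': "pverts G = Y \<union> X" "Y \<inter> X = {}" using V XY by auto
    show ?thesis
    proof (cases "U \<subseteq> X")
      case True
      then have "x \<in> X" using that by auto
      then show ?thesis
        using card_neighbours_switching[OF V XY, of x W] True split[OF that(2)]
        by (auto simp: r[OF that] cardn[OF that(2)])
    next
      case False
      then have "x \<in> Y" using that split[of U] by auto
      then show ?thesis
        using card_neighbours_switching[OF V', of x W] False split[OF that(2)]
        by (auto simp: switching_commute[of G X Y] r[OF that] cardn[OF that(2)])
    qed
  qed
  have sub: "Ws ! i \<subseteq> X \<longleftrightarrow> i < 2" if "i < 4" for i
  proof -
    have "i = 0 \<or> i = 1 \<or> i = 2 \<or> i = 3" using that by auto
    moreover have "\<not> C \<subseteq> X" "\<not> D \<subseteq> X" using XY rep[OF inP(3)] rep[OF inP(4)] by (auto simp: Y_def)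
    ultimately show ?thesis by (auto simp: Ws_def X_def)
  qed
  have len: "length Ws = 4" by (simp add: Ws_def)
  have Ws: "Ws ! i \<in> P" if "i < 4" for i
    using num that nth_mem[of i Ws] len by (simp add: numbering_of_def)
  have "has_quotient_matrix ?H Ws R"
    unfolding has_quotient_matrix_def len
  proof (intro conjI allI impI ballI)
    show "R \<in> carrier_mat 4 4" by (simp add: R_def)
    show "card (neighbours ?H x \<inter> Ws ! j) = R $$ (i, j)"
      if "i < 4" "j < 4" "x \<in> Ws ! i" for i j x
      using that by (simp add: q[OF Ws Ws] sub R_def)
  qed
  moreover have "R \<in> {mat_of_rows_list 4
             [[n - 1, 1, 1, 1],
              [1, n - 1, 1, 1],
              [1, 1, n - 1, 1],
              [1, 1, 1, n - 1]],
           mat_of_rows_list 4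
             [[1, n - 1, 1, 1],
              [n - 1, 1, 1, 1],
              [1, 1, n - 1, 1],
              [1, 1, 1, n - 1]],
           mat_of_rows_list 4
             [[1, n - 1, 1, 1],
              [n - 1, 1, 1, 1],
              [1, 1, 1, n - 1],
              [1, 1, n - 1, 1]]}" (is "R \<in> {?R1, ?R2, ?R3}")
  proof -
    have all: "(\<forall>i<4. Q i) \<longleftrightarrow> Q 0 \<and> Q 1 \<and> Q 2 \<and> Q 3" for Q :: "nat \<Rightarrow> bool"
      by (auto simp: numeral_eq_Suc less_Suc_eq)
    have eq: "R = M \<longleftrightarrow> (\<forall>i<4. \<forall>j<4. R $$ (i, j) = M $$ (i, j))" if "M \<in> carrier_mat 4 4" for M
      using that by (auto simp: R_def intro!: eq_matI)
    have carr: "?R1 \<in> carrier_mat 4 4" "?R2 \<in> carrier_mat 4 4" "?R3 \<in> carrier_mat 4 4"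
      by (auto simp: mat_of_rows_list_def)
    have nn: "n - (n - Suc 0) = Suc 0" using assms(1) by simp
    \<comment> \<open>A class fixed by \<open>f\<close> has diagonal entry 1, a swapped one
      \<open>n - 1\<close>; so the cases of \<open>fcases\<close> yield \<open>?R3\<close>,
      \<open>?R2\<close> and \<open>?R1\<close>, in this order.\<close>
    have "R = ?R1 \<or> R = ?R2 \<or> R = ?R3"
      unfolding eq[OF carr(1)] eq[OF carr(2)] eq[OF carr(3)] all
      using fcases by (elim disjE)
        (simp_all add: R_def mat_of_rows_list_def Ws_def f inP ne ne[symmetric] nn)
    then show ?thesis by simp
  qed
  \<comment> \<open>Switching back gives \<open>G\<close> itself, so the identity is the
    isomorphism.\<close>
  moreover have "digraph_iso (with_proj G) (with_proj (switching ?H (Ws ! 0 \<union> Ws ! 1) (Ws ! 2 \<union> Ws ! 3)))"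
    using digraph_iso_refl by (simp add: Ws_def switching_switching flip: X_def Y_def)
  ultimately show ?thesis using H num by blast
qed

end
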